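(* Let $\mathcal X$ be a compact metric space with metric $\operatorname{dist}$, $\mathcal B$ its Borel $\sigma$-algebra, $\mu$ a Borel probability measure on $\mathcal X$, and $W$ a bounded operator on $\mathcal H=L^2(\mathcal X,\mu)$. For $x\in\mathcal X$ and $\varepsilon>0$ put $\vartheta_\varepsilon(x)=\|W\pi_{B_\varepsilon(x)}\|^2$, where $B_\varepsilon(x)=\{y\in\mathcal X:\operatorname{dist}(y,x)<\varepsilon\}$. Then for every $x\in\mathcal X$ the limit $\vartheta(x)=\lim_{\varepsilon\searrow0}\vartheta_\varepsilon(x)$ exists, the function $\vartheta:\mathcal X\to[0,\|W\|^2]$ is measurable, and $$\|W\|_\mu^2\le\int_{\mathcal X}\vartheta\,d\mu .$$
   Context: For $X\in\mathcal B$, $\pi_X:\mathcal H\to\mathcal H$ is the orthogonal projector $\pi_Xf=\mathbf 1_X f$ on $\mathcal H=L^2(\mathcal X,\mu)$ (complex-valued). A partition is a finite family $\chi=\{Y_1,\dots,Y_J\}\subset\mathcal B$ with $\mu(\mathcal X\setminus\bigcup_j Y_j)=0$ and $\mu(Y_j\cap Y_k)=0$ for $j\ne k$. For a bounded operator $W$ on $\mathcal H$ with operator norm $\|W\|$, put $\mathcal M_\chi(W)=\sum_{j=1}^J\mu(Y_j)\|W\pi_{Y_j}\|^2$, and define the $\mu$-norm $\|W\|_\mu=\inf_\chi\sqrt{\mathcal M_\chi(W)}$, the infimum being over all partitions $\chi$. *)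

theory Defs
  imports "HOL-Probability.Probability"
begin

text \<open>
  Elements of \<open>L\<^sup>2(M)\<close> are handled through their representatives: measurable, square-integrable
  complex functions, where equality in \<open>L\<^sup>2(M)\<close> is equality almost everywhere.
\<close>

definition L2_space :: "'a measure \<Rightarrow> ('a \<Rightarrow> complex) set" where
  "L2_space M = {f \<in> borel_measurable M. integrable M (\<lambda>x. (cmod (f x))\<^sup>2)}"

definition L2_norm :: "'a measure \<Rightarrow> ('a \<Rightarrow> complex) \<Rightarrow> real" where
  "L2_norm M f = sqrt (\<integral>x. (cmod (f x))\<^sup>2 \<partial>M)"

text \<open>
  An operator on \<open>L\<^sup>2(M)\<close> is a map on representatives that respects equality almost everywhere;
  accordingly, linearity is required up to equality almost everywhere. The values outside
  \<open>L2_space M\<close> are irrelevant.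
\<close>

definition bounded_operator_L2 :: "'a measure \<Rightarrow> (('a \<Rightarrow> complex) \<Rightarrow> ('a \<Rightarrow> complex)) \<Rightarrow> bool" where
  "bounded_operator_L2 M W \<longleftrightarrow>
     (\<forall>f\<in>L2_space M. W f \<in> L2_space M) \<and>
     (\<forall>f\<in>L2_space M. \<forall>g\<in>L2_space M. (AE x in M. f x = g x) \<longrightarrow> (AE x in M. W f x = W g x)) \<and>
     (\<forall>f\<in>L2_space M. \<forall>g\<in>L2_space M. AE x in M. W (\<lambda>y. f y + g y) x = W f x + W g x) \<and>
     (\<forall>c. \<forall>f\<in>L2_space M. AE x in M. W (\<lambda>y. c * f y) x = c * W f x) \<and>
     (\<exists>C. \<forall>f\<in>L2_space M. L2_norm M (W f) \<le> C * L2_norm M f)"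

definition op_norm_L2 :: "'a measure \<Rightarrow> (('a \<Rightarrow> complex) \<Rightarrow> ('a \<Rightarrow> complex)) \<Rightarrow> real" where
  "op_norm_L2 M W = (SUP f\<in>{f \<in> L2_space M. L2_norm M f \<le> 1}. L2_norm M (W f))"

definition proj_L2 :: "'a set \<Rightarrow> ('a \<Rightarrow> complex) \<Rightarrow> ('a \<Rightarrow> complex)" where
  "proj_L2 Y f = (\<lambda>x. indicator Y x * f x)"

definition mu_partition :: "'a measure \<Rightarrow> nat \<Rightarrow> (nat \<Rightarrow> 'a set) \<Rightarrow> bool" where
  "mu_partition M J Y \<longleftrightarrow>
     (\<forall>j\<in>{1..J}. Y j \<in> sets M) \<and>
     emeasure M (space M - (\<Union>j\<in>{1..J}. Y j)) = 0 \<and>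
     (\<forall>j\<in>{1..J}. \<forall>k\<in>{1..J}. j \<noteq> k \<longrightarrow> emeasure M (Y j \<inter> Y k) = 0)"

definition mu_sum :: "'a measure \<Rightarrow> (('a \<Rightarrow> complex) \<Rightarrow> ('a \<Rightarrow> complex)) \<Rightarrow> nat \<Rightarrow> (nat \<Rightarrow> 'a set) \<Rightarrow> real" where
  "mu_sum M W J Y = (\<Sum>j=1..J. measure M (Y j) * (op_norm_L2 M (W \<circ> proj_L2 (Y j)))\<^sup>2)"

definition mu_norm :: "'a measure \<Rightarrow> (('a \<Rightarrow> complex) \<Rightarrow> ('a \<Rightarrow> complex)) \<Rightarrow> real" where
  "mu_norm M W = Inf {sqrt (mu_sum M W J Y) | J Y. mu_partition M J Y}"

definition vartheta_eps ::
  "'a::metric_space measure \<Rightarrow> (('a \<Rightarrow> complex) \<Rightarrow> ('a \<Rightarrow> complex)) \<Rightarrow> real \<Rightarrow> 'a \<Rightarrow> real" where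
  "vartheta_eps M W \<epsilon> x = (op_norm_L2 M (W \<circ> proj_L2 (ball x \<epsilon>)))\<^sup>2"

definition vartheta ::
  "'a::metric_space measure \<Rightarrow> (('a \<Rightarrow> complex) \<Rightarrow> ('a \<Rightarrow> complex)) \<Rightarrow> 'a \<Rightarrow> real" where
  "vartheta M W x = Lim (at_right 0) (\<lambda>\<epsilon>. vartheta_eps M W \<epsilon> x)"

end

theory Submission
  imports Defs
begin

text \<open>
  The function \<open>\<vartheta>\<close> is upper semicontinuous, since \<open>\<parallel>W \<pi>\<^sub>Y\<parallel>\<close> is monotone in \<open>Y\<close>. For a finite
  partition into measurable pieces \<open>Y\<^sub>j\<close> of diameter below \<open>\<epsilon>\<close>, the sum \<open>\<M>\<^sub>\<chi>(W)\<close> is the integral of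
  the simple function \<open>h\<close> with value \<open>\<parallel>W \<pi>\<^bsub>Y\<^sub>j\<^esub>\<parallel>\<^sup>2\<close> on \<open>Y\<^sub>j\<close>, and \<open>h \<le> \<vartheta>\<^sub>\<epsilon>\<close> because \<open>Y\<^sub>j\<close> lies in
  the \<open>\<epsilon>\<close>-ball around each of its points. As \<open>\<epsilon>\<close> tends to \<open>0\<close>, \<open>max h \<vartheta>\<close> converges pointwise to
  \<open>\<vartheta>\<close>, so dominated convergence gives the bound; measurability of \<open>\<vartheta>\<^sub>\<epsilon>\<close> is not needed.
\<close>

section \<open>Square norms, projections and operator norms\<close>

lemma L2_norm_nonneg: "0 \<le> L2_norm M f"
  by (simp add: L2_norm_def)

lemma zero_in_L2_space: "(\<lambda>_. 0) \<in> L2_space M"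
  by (simp add: L2_space_def)

lemma L2_norm_zero: "L2_norm M (\<lambda>_. 0) = 0"
  by (simp add: L2_norm_def)

lemma proj_L2_in_L2_space:
  assumes "f \<in> L2_space M" "Y \<in> sets M"
  shows "proj_L2 Y f \<in> L2_space M"
proof -
  have [measurable]: "f \<in> borel_measurable M" "Y \<in> sets M"
    and i: "integrable M (\<lambda>x. (cmod (f x))\<^sup>2)"
    using assms by (auto simp: L2_space_def)
  have [measurable]: "proj_L2 Y f \<in> borel_measurable M"
    unfolding proj_L2_def by measurable
  have "integrable M (\<lambda>x. (cmod (proj_L2 Y f x))\<^sup>2)"
    by (rule Bochner_Integration.integrable_bound[OF i])
       (measurable, auto simp: proj_L2_def norm_mult indicator_def)
  then show ?thesis
    by (simp add: L2_space_def)
qed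

lemma L2_norm_proj_L2_le:
  assumes "f \<in> L2_space M" "Y \<in> sets M"
  shows "L2_norm M (proj_L2 Y f) \<le> L2_norm M f"
  unfolding L2_norm_def
proof (intro real_sqrt_le_mono integral_mono)
  show "integrable M (\<lambda>x. (cmod (proj_L2 Y f x))\<^sup>2)"
    using proj_L2_in_L2_space[OF assms] by (simp add: L2_space_def)
  show "integrable M (\<lambda>x. (cmod (f x))\<^sup>2)"
    using assms by (simp add: L2_space_def)
qed (auto simp: proj_L2_def norm_mult indicator_def)

text \<open>The real supremum in \<open>op_norm_L2\<close> is informative only for a set bounded
  above; this supplies that bound for all later comparisons. As \<open>proj_L2 Y\<close> does not
  increase the norm, a bound for \<open>W\<close> also serves for the composition.\<close>

lemma bdd_above_op_norm_proj_L2: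
  assumes W: "bounded_operator_L2 M W" and Y: "Y \<in> sets M"
  shows "bdd_above ((\<lambda>f. L2_norm M ((W \<circ> proj_L2 Y) f)) ` {f \<in> L2_space M. L2_norm M f \<le> 1})"
proof -
  obtain C where C: "\<And>f. f \<in> L2_space M \<Longrightarrow> L2_norm M (W f) \<le> C * L2_norm M f"
    using W unfolding bounded_operator_L2_def by blast
  have "L2_norm M (W (proj_L2 Y f)) \<le> \<bar>C\<bar>" if "f \<in> L2_space M" "L2_norm M f \<le> 1" for f
  proof -
    have "L2_norm M (W (proj_L2 Y f)) \<le> C * L2_norm M (proj_L2 Y f)"
      using that Y by (intro C proj_L2_in_L2_space)
    \<comment> \<open>\<open>C\<close> may be negative, so its absolute value is needed to replace
      the norm of the projected function by 1.\<close>
    also have "\<dots> \<le> \<bar>C\<bar> * 1"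
      using L2_norm_proj_L2_le[OF that(1) Y] that(2)
      by (intro mult_mono) (auto simp: L2_norm_nonneg)
    finally show ?thesis by simp
  qed
  then show ?thesis by (intro bdd_aboveI2[where M = "\<bar>C\<bar>"]) auto
qed

lemma op_norm_proj_L2_nonneg:
  assumes "bounded_operator_L2 M W" "Y \<in> sets M"
  shows "0 \<le> op_norm_L2 M (W \<circ> proj_L2 Y)"
  unfolding op_norm_L2_def
  by (rule cSUP_upper2[OF bdd_above_op_norm_proj_L2[OF assms], of "\<lambda>_. 0"])
     (auto simp: L2_norm_nonneg zero_in_L2_space L2_norm_zero)

text \<open>A test function \<open>f\<close> for \<open>Y\<close> is matched by the test function
  \<open>proj_L2 Y f\<close> for \<open>Z\<close>: its norm is at most that of \<open>f\<close>, and
  \<open>proj_L2 Z\<close> fixes it because \<open>Y\<close> lies in \<open>Z\<close>.\<close>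

lemma op_norm_proj_L2_mono:
  assumes W: "bounded_operator_L2 M W" and YZ: "Y \<subseteq> Z" "Y \<in> sets M" "Z \<in> sets M"
  shows "op_norm_L2 M (W \<circ> proj_L2 Y) \<le> op_norm_L2 M (W \<circ> proj_L2 Z)"
  unfolding op_norm_L2_def
proof (rule cSUP_mono[OF _ bdd_above_op_norm_proj_L2[OF W YZ(3)]])
  show "{f \<in> L2_space M. L2_norm M f \<le> 1} \<noteq> {}"
    using zero_in_L2_space[of M] L2_norm_zero[of M] by force
next
  fix f assume f: "f \<in> {f \<in> L2_space M. L2_norm M f \<le> 1}"
  have "proj_L2 Z (proj_L2 Y f) = proj_L2 Y f"
    using YZ(1) by (auto simp: proj_L2_def indicator_def fun_eq_iff)
  moreover have "proj_L2 Y f \<in> {f \<in> L2_space M. L2_norm M f \<le> 1}"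
    using f proj_L2_in_L2_space[OF _ YZ(2)] L2_norm_proj_L2_le[OF _ YZ(2)] by force
  ultimately show "\<exists>g\<in>{f \<in> L2_space M. L2_norm M f \<le> 1}.
      L2_norm M ((W \<circ> proj_L2 Y) f) \<le> L2_norm M ((W \<circ> proj_L2 Z) g)"
    by (intro bexI[of _ "proj_L2 Y f"]) auto
qed

text \<open>This makes the bound by the norm of \<open>W\<close> itself an instance of monotonicity
  in the set.\<close>

lemma proj_L2_UNIV: "W \<circ> proj_L2 UNIV = W"
  by (simp add: proj_L2_def fun_eq_iff)

section \<open>The \<mu>-norm and partitions into small pieces\<close>

lemma mu_sum_nonneg: "0 \<le> mu_sum M W J Y"
  by (auto simp: mu_sum_def intro!: sum_nonneg)

lemma mu_norm_power2_le_mu_sum: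
  assumes "mu_partition M J Y"
  shows "(mu_norm M W)\<^sup>2 \<le> mu_sum M W J Y"
proof -
  let ?S = "{sqrt (mu_sum M W J Y) | J Y. mu_partition M J Y}"
  have mem: "sqrt (mu_sum M W J Y) \<in> ?S" using assms by blast
  have "mu_norm M W \<le> sqrt (mu_sum M W J Y)"
    unfolding mu_norm_def using mem
    by (rule cInf_lower) (auto intro!: bdd_belowI[of _ 0] simp: mu_sum_nonneg)
  \<comment> \<open>Squaring preserves the inequality only for a nonnegative infimum; the given
    partition shows that the infimum is over a nonempty set.\<close>
  moreover have "0 \<le> mu_norm M W"
    unfolding mu_norm_def using mem by (intro cInf_greatest) (auto simp: mu_sum_nonneg)
  ultimately have "(mu_norm M W)\<^sup>2 \<le> (sqrt (mu_sum M W J Y))\<^sup>2"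
    by (intro power_mono)
  then show ?thesis by (simp add: mu_sum_nonneg)
qed

text \<open>Total boundedness gives a finite cover by balls of radius \<open>e/2\<close>; removing
  from each ball the earlier ones makes the pieces disjoint, and two points of one piece are less
  than \<open>e\<close> apart. The removal starts at index 1, so disjointness is claimed only from
  there on.\<close>

lemma compact_UNIV_small_borel_partition:
  fixes e :: real
  assumes "compact (UNIV :: 'a::metric_space set)" "e > 0"
  obtains J and Y :: "nat \<Rightarrow> 'a::metric_space set" where
    "\<And>j. Y j \<in> sets borel" "\<And>x. \<exists>j\<in>{1..J}. x \<in> Y j"
    "\<And>j k. 1 \<le> j \<Longrightarrow> j < k \<Longrightarrow> Y j \<inter> Y k = {}" "\<And>j x. x \<in> Y j \<Longrightarrow> Y j \<subseteq> ball x e"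
proof -
  obtain K :: "'a set" where K: "finite K" "UNIV \<subseteq> (\<Union>x\<in>K. ball x (e/2))"
    using assms unfolding compact_eq_totally_bounded by (meson half_gt_zero)
  obtain c where "bij_betw c {1..card K} K"
    using ex_bij_betw_nat_finite_1[OF K(1)] by blast
  then have c: "K = c ` {1..card K}" by (simp add: bij_betw_def)
  define B where "B j = ball (c j) (e/2)" for j
  define Y where "Y j = B j - (\<Union>i\<in>{1..<j}. B i)" for j
  show thesis
  proof (rule that[of Y "card K"])
    show "Y j \<in> sets borel" for j
      unfolding Y_def B_def by (intro sets.Diff sets.finite_UN) auto
    show "\<exists>j\<in>{1..card K}. x \<in> Y j" for x
    proof -
      \<comment> \<open>The piece containing \<open>x\<close> belongs to the first ball that
        contains \<open>x\<close>.\<close>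
      define P where "P j \<longleftrightarrow> 1 \<le> j \<and> x \<in> B j" for j
      obtain z where z: "z \<in> K" "x \<in> ball z (e/2)" using K(2) by blast
      from z(1) obtain j where j: "j \<in> {1..card K}" "z = c j" by (subst (asm) c) (rule imageE)
      then have P: "P j" using z(2) by (simp add: B_def P_def)
      have 1: "P (Least P)" by (rule LeastI[of P, OF P])
      have 2: "Least P \<le> j" by (rule Least_le[of P, OF P])
      have "x \<notin> B i" if "i \<in> {1..<Least P}" for i
        using not_less_Least[of i P] that unfolding P_def[of i] by simp
      then have "x \<in> Y (Least P)" using 1 by (simp add: Y_def P_def)
      moreover have "Least P \<in> {1..card K}" using 1 2 j(1) by (simp add: P_def)
      ultimately show ?thesis by blast
    qed
    show "Y j \<subseteq> ball x e" if "x \<in> Y j" for j x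
    proof
      fix y assume "y \<in> Y j"
      then have "dist (c j) y < e/2" "dist (c j) x < e/2" using that by (auto simp: Y_def B_def)
      then show "y \<in> ball x e"
        using dist_triangle_half_r[of "c j" x e y] by simp
    qed
    show "Y j \<inter> Y k = {}" if "1 \<le> j" "j < k" for j k
      using that by (auto simp: Y_def)
  qed
qed

section \<open>One-sided limits of monotone functions\<close>

lemma tendsto_at_right_INF:
  fixes f :: "real \<Rightarrow> real"
  assumes mono: "\<And>x y. 0 < x \<Longrightarrow> x \<le> y \<Longrightarrow> f x \<le> f y" and bdd: "bdd_below (f ` {0<..})"
  shows "(f \<longlongrightarrow> (INF x\<in>{0<..}. f x)) (at_right 0)"
proof (rule order_tendstoI)
  fix a assume "a < (INF x\<in>{0<..}. f x)"
  then have "a < f x" if "x > 0" for x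
    using cINF_lower[OF bdd, of x] that by simp
  then show "\<forall>\<^sub>F x in at_right 0. a < f x"
    by (auto simp: eventually_at_right_field intro: exI[of _ 1])
next
  \<comment> \<open>One point \<open>e\<close> with \<open>f e < a\<close> suffices: monotonicity
    carries the inequality to all of the interval from 0 to \<open>e\<close>.\<close>
  fix a assume "(INF x\<in>{0<..}. f x) < a"
  then obtain e where e: "e > 0" "f e < a"
    using cINF_less_iff[OF _ bdd] by auto
  then show "\<forall>\<^sub>F x in at_right 0. f x < a"
    unfolding eventually_at_right_field
    using e mono by (intro exI[of _ e]) (auto intro: le_less_trans[of _ "f e"])
qed

section \<open>Existence, bounds and measurability of the limit function\<close>

locale L2_operator_on_compact_space = prob_space M
  for M :: "'a::metric_space measure" +
  fixes W :: "('a \<Rightarrow> complex) \<Rightarrow> ('a \<Rightarrow> complex)"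
  assumes compact_UNIV: "compact (UNIV :: 'a set)"
    and sets_M: "sets M = sets borel"
    and bounded_W: "bounded_operator_L2 M W"
begin

lemma space_M: "space M = UNIV"
  using sets_eq_imp_space_eq[OF sets_M] by simp

lemma vartheta_eps_nonneg: "0 \<le> vartheta_eps M W e x"
  by (simp add: vartheta_eps_def)

lemma op_norm_power2_mono:
  assumes "Y \<subseteq> Z" "Y \<in> sets borel" "Z \<in> sets borel"
  shows "(op_norm_L2 M (W \<circ> proj_L2 Y))\<^sup>2 \<le> (op_norm_L2 M (W \<circ> proj_L2 Z))\<^sup>2"
  using assms sets_M
  by (intro power_mono op_norm_proj_L2_mono[OF bounded_W] op_norm_proj_L2_nonneg[OF bounded_W]) auto

lemma op_norm_proj_L2_power2_le:
  assumes "Y \<in> sets borel"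
  shows "(op_norm_L2 M (W \<circ> proj_L2 Y))\<^sup>2 \<le> (op_norm_L2 M W)\<^sup>2"
  using op_norm_power2_mono[OF subset_UNIV assms] by (simp add: proj_L2_UNIV)

text \<open>Different centres are allowed, so that one lemma covers both shrinking radii at a fixed
  point and the comparison of nearby points behind semicontinuity.\<close>

lemma vartheta_eps_mono:
  "ball x d \<subseteq> ball y e \<Longrightarrow> vartheta_eps M W d x \<le> vartheta_eps M W e y"
  unfolding vartheta_eps_def by (rule op_norm_power2_mono) auto

lemma bdd_below_vartheta_eps: "bdd_below ((\<lambda>e. vartheta_eps M W e x) ` A)"
  by (auto intro!: bdd_belowI[of _ 0] simp: vartheta_eps_nonneg)

lemma vartheta_eps_tendsto_INF:
  "((\<lambda>e. vartheta_eps M W e x) \<longlongrightarrow> (INF e\<in>{0<..}. vartheta_eps M W e x)) (at_right 0)"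
  by (rule tendsto_at_right_INF) (auto intro!: vartheta_eps_mono bdd_below_vartheta_eps)

text \<open>\<open>Lim\<close> is a definite description, determined here by convergence along a
  nontrivial filter. The infimum form turns later estimates into choices of a single radius.\<close>

lemma vartheta_eq_INF: "vartheta M W x = (INF e\<in>{0<..}. vartheta_eps M W e x)"
  unfolding vartheta_def by (rule tendsto_Lim[OF _ vartheta_eps_tendsto_INF]) simp

lemma tendsto_vartheta: "((\<lambda>e. vartheta_eps M W e x) \<longlongrightarrow> vartheta M W x) (at_right 0)"
  using vartheta_eps_tendsto_INF by (simp add: vartheta_eq_INF)

lemma vartheta_le_vartheta_eps: "e > 0 \<Longrightarrow> vartheta M W x \<le> vartheta_eps M W e x"
  unfolding vartheta_eq_INF by (rule cINF_lower[OF bdd_below_vartheta_eps]) simp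

lemma vartheta_nonneg: "0 \<le> vartheta M W x"
  unfolding vartheta_eq_INF by (rule cINF_greatest) (auto simp: vartheta_eps_nonneg)

lemma vartheta_le: "vartheta M W x \<le> (op_norm_L2 M W)\<^sup>2"
proof -
  have "vartheta M W x \<le> vartheta_eps M W 1 x" by (rule vartheta_le_vartheta_eps) simp
  also have "\<dots> \<le> (op_norm_L2 M W)\<^sup>2"
    unfolding vartheta_eps_def by (rule op_norm_proj_L2_power2_le) simp
  finally show ?thesis .
qed

lemma borel_measurable_vartheta: "vartheta M W \<in> borel_measurable M"
proof -
  have "open {x. vartheta M W x < a}" for a
    unfolding open_contains_ball
  proof
    fix x assume "x \<in> {x. vartheta M W x < a}"
    then obtain e where e: "e > 0" "vartheta_eps M W e x < a"
      using cINF_less_iff[OF _ bdd_below_vartheta_eps] by (auto simp: vartheta_eq_INF)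
    \<comment> \<open>Halving the radius works because the ball of radius \<open>e/2\<close> around
      such a \<open>y\<close> stays inside \<open>ball x e\<close>.\<close>
    have "vartheta M W y < a" if y: "y \<in> ball x (e/2)" for y
    proof -
      have "vartheta M W y \<le> vartheta_eps M W (e/2) y"
        using e by (intro vartheta_le_vartheta_eps) simp
      also have "\<dots> \<le> vartheta_eps M W e x"
      proof (rule vartheta_eps_mono, rule subsetI)
        fix z assume "z \<in> ball y (e/2)"
        then show "z \<in> ball x e"
          using y dist_triangle_half_r[of y x e z] by (simp add: dist_commute)
      qed
      finally show ?thesis using e by simp
    qed
    then show "\<exists>d>0. ball x d \<subseteq> {x. vartheta M W x < a}"
      using e by (intro exI[of _ "e/2"]) auto
  qed
  then have "vartheta M W \<in> borel_measurable borel"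
    by (intro borel_measurableI_less) (simp add: borel_open)
  then show ?thesis
    by (subst measurable_cong_sets[OF sets_M refl])
qed

section \<open>The integral bound\<close>

lemma ex_simple_function_below_vartheta_eps:
  assumes "e > 0"
  obtains h where "h \<in> borel_measurable M" "integrable M h" "(mu_norm M W)\<^sup>2 \<le> (\<integral>x. h x \<partial>M)"
    "\<And>x. 0 \<le> h x" "\<And>x. h x \<le> vartheta_eps M W e x"
proof -
  obtain J and Y :: "nat \<Rightarrow> 'a set" where Y:
    "\<And>j. Y j \<in> sets borel" "\<And>x. \<exists>j\<in>{1..J}. x \<in> Y j"
    "\<And>j k. 1 \<le> j \<Longrightarrow> j < k \<Longrightarrow> Y j \<inter> Y k = {}" "\<And>j x. x \<in> Y j \<Longrightarrow> Y j \<subseteq> ball x e"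
    by (rule compact_UNIV_small_borel_partition[OF compact_UNIV assms]) (rule that)
  have disj: "Y j \<inter> Y k = {}" if "1 \<le> j" "1 \<le> k" "j \<noteq> k" for j k
    using that Y(3) by (metis Int_commute linorder_neqE_nat)
  define N where "N j = (op_norm_L2 M (W \<circ> proj_L2 (Y j)))\<^sup>2" for j
  define h where "h x = (\<Sum>j=1..J. N j * indicator (Y j) x)" for x
  have [measurable]: "Y j \<in> sets M" for j using Y(1) sets_M by simp
  \<comment> \<open>By disjointness exactly one summand of \<open>h x\<close> survives.\<close>
  have h_eq: "h x = N j" if "j \<in> {1..J}" "x \<in> Y j" for x j
  proof -
    have "h x = (\<Sum>k=1..J. if k = j then N j else 0)"
      unfolding h_def using that disj by (intro sum.cong) (auto simp: indicator_def)
    then show ?thesis using that by simp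
  qed
  have "(\<Union>j\<in>{1..J}. Y j) = UNIV" using Y(2) by blast
  then have "mu_partition M J Y"
    using disj by (auto simp: mu_partition_def space_M)
  then have "(mu_norm M W)\<^sup>2 \<le> mu_sum M W J Y" by (rule mu_norm_power2_le_mu_sum)
  \<comment> \<open>Each weight \<open>measure M (Y j)\<close> is the integral of the indicator of
    \<open>Y j\<close>; the finite measure makes all summands integrable.\<close>
  also have "\<dots> = (\<integral>x. h x \<partial>M)"
    unfolding h_def mu_sum_def N_def
    by (subst Bochner_Integration.integral_sum)
       (auto simp: less_top[symmetric] mult.commute)
  finally have *: "(mu_norm M W)\<^sup>2 \<le> (\<integral>x. h x \<partial>M)" .
  show thesis
  proof (rule that[of h])
    show "h \<in> borel_measurable M" unfolding h_def by measurable
    show "integrable M h" unfolding h_def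
      by (intro Bochner_Integration.integrable_sum integrable_mult_right integrable_real_indicator)
         (auto simp: less_top[symmetric])
    show "0 \<le> h x" for x unfolding h_def N_def by (intro sum_nonneg) auto
    show "h x \<le> vartheta_eps M W e x" for x
    proof -
      obtain j where j: "j \<in> {1..J}" "x \<in> Y j" using Y(2) by blast
      show ?thesis
        unfolding h_eq[OF j] N_def vartheta_eps_def using Y(1) Y(4)[OF j(2)]
        by (intro op_norm_power2_mono) auto
    qed
  qed (rule *)
qed

lemma mu_norm_power2_le_integral_vartheta: "(mu_norm M W)\<^sup>2 \<le> (\<integral>x. vartheta M W x \<partial>M)"
proof -
  have "\<exists>h. h \<in> borel_measurable M \<and> integrable M h \<and> (mu_norm M W)\<^sup>2 \<le> (\<integral>x. h x \<partial>M) \<and>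
     (\<forall>x. 0 \<le> h x) \<and> (\<forall>x. h x \<le> vartheta_eps M W (inverse (real (Suc n))) x)" for n
    by (rule ex_simple_function_below_vartheta_eps[of "inverse (real (Suc n))"]) auto
  then obtain h where [measurable]: "\<And>n. h n \<in> borel_measurable M"
    and h: "\<And>n. integrable M (h n)" "\<And>n. (mu_norm M W)\<^sup>2 \<le> (\<integral>x. h n x \<partial>M)" "\<And>n x. 0 \<le> h n x"
      "\<And>n x. h n x \<le> vartheta_eps M W (inverse (real (Suc n))) x"
    by metis
  note [measurable] = borel_measurable_vartheta
  \<comment> \<open>The sequence \<open>h n x\<close> is bounded above by one tending to
    \<open>vartheta M W x\<close>, but may itself fail to converge. The maximum adds the lower bound
    for a sandwich and can only raise the integral.\<close>
  define g where "g n x = max (h n x) (vartheta M W x)" for n x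
  have g_le: "g n x \<le> vartheta_eps M W (inverse (real (Suc n))) x" for n x
    unfolding g_def using h(4) by (simp add: vartheta_le_vartheta_eps)
  have g_bound: "norm (g n x) \<le> (op_norm_L2 M W)\<^sup>2" for n x
  proof -
    have "g n x \<le> (op_norm_L2 M W)\<^sup>2"
      using g_le[of n x] op_norm_proj_L2_power2_le[of "ball x (inverse (real (Suc n)))"]
      by (simp add: vartheta_eps_def)
    moreover have "0 \<le> g n x" using h(3)[of n x] by (simp add: g_def max.coboundedI1)
    ultimately show ?thesis by simp
  qed
  have g_meas [measurable]: "g n \<in> borel_measurable M" for n unfolding g_def by measurable
  have lim: "(\<lambda>n. g n x) \<longlonglongrightarrow> vartheta M W x" for x
  proof (rule tendsto_sandwich)
    show "\<forall>\<^sub>F n in sequentially. vartheta M W x \<le> g n x"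
      by (simp add: g_def)
    show "\<forall>\<^sub>F n in sequentially. g n x \<le> vartheta_eps M W (inverse (real (Suc n))) x"
      using g_le by simp
    \<comment> \<open>The radii \<open>inverse (real (Suc n))\<close> are strictly positive, as
      approach from the right requires.\<close>
    have "filterlim (\<lambda>n. inverse (real (Suc n))) (at_right 0) sequentially"
      using LIMSEQ_inverse_real_of_nat by (auto simp: filterlim_at)
    then show "(\<lambda>n. vartheta_eps M W (inverse (real (Suc n))) x) \<longlonglongrightarrow> vartheta M W x"
      by (rule filterlim_compose[OF tendsto_vartheta])
  qed simp
  \<comment> \<open>The dominating constant is integrable because the measure is a probability
    measure.\<close>
  have "(\<lambda>n. \<integral>x. g n x \<partial>M) \<longlonglongrightarrow> (\<integral>x. vartheta M W x \<partial>M)"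
    by (rule integral_dominated_convergence[where w = "\<lambda>_. (op_norm_L2 M W)\<^sup>2"])
       (simp_all add: lim g_bound del: real_norm_def)
  moreover have "(mu_norm M W)\<^sup>2 \<le> (\<integral>x. g n x \<partial>M)" for n
  proof -
    have "integrable M (g n)"
      by (rule integrable_const_bound[where B = "(op_norm_L2 M W)\<^sup>2"]) (simp_all only: g_bound g_meas AE_I2)
    then have "(\<integral>x. h n x \<partial>M) \<le> (\<integral>x. g n x \<partial>M)"
      by (rule integral_mono[OF h(1)]) (simp add: g_def)
    then show ?thesis using h(2)[of n] by simp
  qed
  ultimately show ?thesis
    by (intro LIMSEQ_le_const) auto
qed

end

theorem proposition5p1:
  fixes M :: "'a::metric_space measure"
    and W :: "('a \<Rightarrow> complex) \<Rightarrow> ('a \<Rightarrow> complex)"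
  assumes "compact (UNIV :: 'a set)"
    and "prob_space M"
    and "sets M = sets borel"
    and "bounded_operator_L2 M W"
  shows "(\<forall>x. ((\<lambda>\<epsilon>. vartheta_eps M W \<epsilon> x) \<longlongrightarrow> vartheta M W x) (at_right 0)) \<and>
         (\<forall>x. vartheta M W x \<in> {0..(op_norm_L2 M W)\<^sup>2}) \<and>
         vartheta M W \<in> borel_measurable M \<and>
         (mu_norm M W)\<^sup>2 \<le> (\<integral>x. vartheta M W x \<partial>M)"
proof -
  interpret L2_operator_on_compact_space M W
    using assms by (simp add: L2_operator_on_compact_space_def L2_operator_on_compact_space_axioms_def)
  show ?thesis
    using tendsto_vartheta vartheta_nonneg vartheta_le borel_measurable_vartheta
      mu_norm_power2_le_integral_vartheta by simp
qed

end
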